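(* Let $N\in\mathrm{GL}(2,\mathbb{Z})$ with $\mathrm{Spec}_{\mathbb{R}}(N)\cap\,]1,+\infty[\,\neq\emptyset$. Fix $\alpha\in\mathrm{Spec}(N)\cap\,]1,+\infty[$ and an eigenvector $a\in\mathbb{R}^2\setminus\{0\}$ for the eigenvalue $\alpha$. (1) The group $Z^+_{\mathrm{SL}(2,\mathbb{Z})}(N):=\{K\in\mathrm{SL}(2,\mathbb{Z})\mid KN=NK,\ Ka\in\mathbb{R}^*_+a\}$ is infinite cyclic. (2) Suppose $\alpha\notin\mathbb{Q}$. Then $Z^+_{\mathrm{GL}(2,\mathbb{Z})}(N):=\{K\in\mathrm{GL}(2,\mathbb{Z})\mid KN=NK,\ Ka\in\mathbb{R}^*_+a\}$ is also infinite cyclic.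
   Context: $\mathrm{Spec}_{\mathbb{R}}(N)$ is the set of real eigenvalues of $N$; $\mathbb{R}^*_+$ is the set of positive real numbers. *)

theory Defs
  imports
    Complex_Main
    "HOL-Algebra.Elementary_Groups"
    "Jordan_Normal_Form.Spectral_Radius"
begin

definition GL2Z :: "int mat monoid" where
  "GL2Z = units_of (ring_mat TYPE(int) 2 ())"

definition SL2Z :: "int mat monoid" where
  "SL2Z = GL2Z\<lparr>carrier := {K \<in> carrier GL2Z. det K = 1}\<rparr>"

abbreviation real_mat :: "int mat \<Rightarrow> real mat" where
  "real_mat \<equiv> map_mat real_of_int"

definition Zplus :: "int mat monoid \<Rightarrow> int mat \<Rightarrow> real vec \<Rightarrow> int mat monoid" where
  "Zplus G N a = G\<lparr>carrier := {K \<in> carrier G. K * N = N * K \<and>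
     (\<exists>c>0. real_mat K *\<^sub>v a = c \<cdot>\<^sub>v a)}\<rparr>"

(* The library's cyclic_group does not itself assert the group axioms. *)
definition infinite_cyclic_group :: "('a, 'b) monoid_scheme \<Rightarrow> bool" where
  "infinite_cyclic_group G \<longleftrightarrow> group G \<and> cyclic_group G \<and> infinite (carrier G)"

end

(* A rational root of x^2 - t x + d with d = 1 or d = -1 is 1 or -1, so alpha > 1 is irrational and
   the two coordinates of a are linearly independent over the rationals. Hence an integer matrix
   having a as an eigenvector is determined by the eigenvalue, and K |-> eigenvalue embeds the group
   into the positive reals. An eigenvalue c in ]1,B] is a root of one of finitely many polynomials
   x^2 - t x + d with d = 1 or d = -1 and |t| <= B + 1, so the image is discrete; it contains
   alpha^2 > 1, the eigenvalue of N^2, which has determinant 1. A nontrivial discrete subgroup of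
   the positive reals is generated by its least element above 1. *)

theory Submission
  imports Defs
begin

section \<open>Cyclicity from a discrete embedding into the positive reals\<close>

text \<open>Euclidean division in the image of \<open>h\<close>: dividing \<open>h x\<close> by a
  power of the least value above 1 leaves a remainder that must be 1, and injectivity lifts the
  resulting equality of values to the group.\<close>

lemma (in group) infinite_cyclic_group_if_discrete_character:
  fixes h :: "'a \<Rightarrow> real"
  assumes pos: "\<And>x. x \<in> carrier G \<Longrightarrow> 0 < h x"
    and mult: "\<And>x y. \<lbrakk>x \<in> carrier G; y \<in> carrier G\<rbrakk> \<Longrightarrow> h (x \<otimes> y) = h x * h y"
    and inj: "inj_on h (carrier G)"
    and fin: "\<And>B. finite {x \<in> carrier G. 1 < h x \<and> h x \<le> B}"
    and y: "y \<in> carrier G" "1 < h y"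
  shows "infinite_cyclic_group G"
proof -
  have one: "h \<one> = 1"
    using mult[of \<one> \<one>] pos[of \<one>] by simp
  have inv: "h (inv x) = inverse (h x)" if "x \<in> carrier G" for x
    using mult[OF that inv_closed[OF that]] that one by (intro inverse_unique[symmetric]) simp
  have npow: "h (x [^] (n::nat)) = h x ^ n" if "x \<in> carrier G" for x n
  proof (induction n)
    case (Suc n)
    then show ?case
      using mult[OF nat_pow_closed[OF that] that] by simp
  qed (simp add: one)
  have ipow: "h (x [^] (n::int)) = h x powi n" if "x \<in> carrier G" for x n
  proof (cases n rule: int_cases2)
    case (nonneg m)
    then show ?thesis
      using npow[OF that, of m] by (simp add: int_pow_int)
  next
    case (nonpos m)
    then have "x [^] n = inv (x [^] m)"
      using that by (simp add: int_pow_neg int_pow_int)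
    then show ?thesis
      using npow[OF that, of m] inv[of "x [^] m"] that
      by (simp only: nonpos power_int_minus power_int_of_nat nat_pow_closed)
  qed
  \<comment> \<open>The window up to \<open>h y\<close> is finite and contains \<open>y\<close>, so
    \<open>h\<close> attains a minimum on it. Values beyond the window exceed \<open>h y\<close>, so
    this minimum is the least value above 1 on the whole group.\<close>
  define S where "S = {x \<in> carrier G. 1 < h x \<and> h x \<le> h y}"
  have S: "finite S" "S \<noteq> {}"
    using fin y by (auto simp: S_def)
  obtain g where g: "g \<in> S" and gmin: "\<And>x. x \<in> S \<Longrightarrow> h g \<le> h x"
    using ex_is_arg_min_if_finite[OF S, of h] by (auto simp: is_arg_min_linorder)
  have gG: "g \<in> carrier G" and g1: "1 < h g"
    using g by (auto simp: S_def)
  have no_small: "\<not> h x < h g" if "x \<in> carrier G" "1 < h x" for x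
    using that gmin[of x] g by (force simp: S_def)
  have gen: "\<exists>n::int. x = g [^] n" if x: "x \<in> carrier G" for x
  proof -
    \<comment> \<open>The largest power of \<open>h g\<close> not exceeding \<open>h x\<close> has
      exponent \<open>n\<close>; dividing by it leaves a quotient in [1,
      \<open>h g\<close>).\<close>
    define n where "n = \<lfloor>log (h g) (h x)\<rfloor>"
    have lb: "h g powi n \<le> h x"
      using pos[OF x] g1 by (simp add: n_def powr_real_of_int' [symmetric] powr_le_iff)
    have ub: "h x < h g powi n * h g"
    proof -
      have "h x < h g powr (real_of_int n + 1)"
        using pos[OF x] g1 unfolding n_def
        by (metis floor_correct log_less_iff of_int_1 of_int_add)
      then show ?thesis
        using g1 by (simp add: powr_add powr_real_of_int' [symmetric])
    qed
    let ?z = "x \<otimes> g [^] (- n)"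
    have z: "?z \<in> carrier G"
      using x gG by simp
    have hz: "h ?z = h x / h g powi n"
      using x gG by (simp add: mult ipow power_int_minus field_simps)
    have p: "0 < h g powi n"
      using g1 by simp
    have "1 \<le> h ?z" "h ?z < h g"
      using lb ub p by (simp_all add: hz field_simps)
    with no_small[OF z] have "h ?z = 1"
      by fastforce
    then have "h x = h (g [^] n)"
      using p gG by (simp add: hz ipow)
    then show ?thesis
      using inj x gG by (auto dest: inj_onD)
  qed
  have "cyclic_group G"
    unfolding cyclic_group using gen gG by (intro bexI[of _ g]) auto
  \<comment> \<open>Since \<open>h g\<close> exceeds 1, its powers are distinct, hence so are those
    of \<open>g\<close>.\<close>
  moreover have "inj (\<lambda>n::nat. g [^] n)"
  proof (rule injI)
    fix m n :: nat
    assume "g [^] m = g [^] n"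
    then have "h g ^ m = h g ^ n"
      using npow[OF gG] by metis
    then show "m = n"
      using g1 by simp
  qed
  then have "infinite (carrier G)"
    using gG by (intro infinite_super[OF _ range_inj_infinite]) auto
  ultimately show ?thesis
    unfolding infinite_cyclic_group_def using group_axioms by blast
qed

section \<open>Integer matrices of size two and rational roots of their characteristic
  polynomials\<close>

lemma det_carrier_mat_2:
  assumes "A \<in> carrier_mat 2 2"
  shows "det A = A $$ (0,0) * A $$ (1,1) - A $$ (0,1) * A $$ (1,0)"
proof -
  \<comment> \<open>The minors are of size one, so each equals its only entry.\<close>
  have "det (mat_delete A 0 j) = mat_delete A 0 j $$ (0,0)" for j
    using assms by (intro det_single) (auto simp: mat_delete_def)
  then show ?thesis
    using assms
    by (simp add: laplace_expansion_row[OF assms, of 0] numeral_2_eq_2 cofactor_def mat_delete_def)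
qed

lemma real_mat_mult_eq_smult_iff:
  assumes "K \<in> carrier_mat 2 2" "a \<in> carrier_vec 2"
  shows "real_mat K *\<^sub>v a = c \<cdot>\<^sub>v a \<longleftrightarrow>
    K $$ (0,0) * a $ 0 + K $$ (0,1) * a $ 1 = c * a $ 0 \<and>
    K $$ (1,0) * a $ 0 + K $$ (1,1) * a $ 1 = c * a $ 1"
  using assms by (auto simp: vec_eq_iff scalar_prod_def numeral_2_eq_2 less_Suc_eq)

lemma real_mat_mult:
  assumes "K \<in> carrier_mat n n" "L \<in> carrier_mat n n"
  shows "real_mat (K * L) = real_mat K * real_mat L"
  using of_int_hom.mat_hom_mult[OF assms] .

lemma carrier_GL2Z: "carrier GL2Z \<subseteq> carrier_mat 2 2"
  by (auto simp: GL2Z_def units_of_def Units_def ring_mat_simps)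

lemma mult_GL2Z: "(\<otimes>\<^bsub>GL2Z\<^esub>) = (*)" and one_GL2Z: "\<one>\<^bsub>GL2Z\<^esub> = 1\<^sub>m 2"
  by (simp_all add: GL2Z_def units_of_mult units_of_one ring_mat_simps)

lemma group_GL2Z: "group GL2Z"
  unfolding GL2Z_def
  by (intro monoid.units_group) (rule semiring.axioms(2)[OF semiring_mat])

text \<open>The determinants of \<open>K\<close> and of its inverse are integers with product
  1.\<close>

lemma det_GL2Z:
  assumes "K \<in> carrier GL2Z"
  shows "det K = 1 \<or> det K = -1"
proof -
  interpret group GL2Z by (rule group_GL2Z)
  have "K * inv\<^bsub>GL2Z\<^esub> K = 1\<^sub>m 2"
    using r_inv[OF assms] by (simp add: mult_GL2Z one_GL2Z)
  then have "det K * det (inv\<^bsub>GL2Z\<^esub> K) = 1"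
    using det_mult[of K 2 "inv\<^bsub>GL2Z\<^esub> K"] carrier_GL2Z assms inv_closed by auto
  then show ?thesis
    by (simp add: zmult_eq_1_iff) blast
qed

text \<open>A rational algebraic integer is an integer \<open>m\<close>, and the equation reads
  \<open>m * (t - m) = d\<close>, so \<open>m\<close> divides a unit.\<close>

lemma rational_root_unit:
  fixes x :: real and t d :: int
  assumes root: "x\<^sup>2 - t * x + d = 0" and d: "d = 1 \<or> d = -1" and "x \<in> \<rat>"
  shows "\<bar>x\<bar> = 1"
proof -
  have "algebraic_int x"
    unfolding algebraic_int.simps
    using root by (intro exI[of _ x] conjI exI[of _ "[:of_int d, - of_int t, 1:]"])
      (auto simp: coeff_pCons power2_eq_square algebra_simps split: nat.split)
  then have "x \<in> \<int>"
    using rational_algebraic_int_is_int \<open>x \<in> \<rat>\<close> by blast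
  then obtain m where m: "x = of_int m"
    by (auto elim: Ints_cases)
  have "of_int (m * (t - m)) = (of_int d :: real)"
    using root by (simp add: m power2_eq_square algebra_simps)
  then have "m dvd d"
    by (metis dvd_triv_left of_int_eq_iff)
  with d have "\<bar>m\<bar> = 1"
    by auto
  then show ?thesis
    using m by auto
qed

section \<open>Eigenvalues of integer matrices at the fixed eigenvector\<close>

locale unimodular_eigenvector =
  fixes N :: "int mat" and \<alpha> :: real and a :: "real vec"
  assumes N: "N \<in> carrier GL2Z" and gt_1: "1 < \<alpha>"
    and eigenvector: "eigenvector (real_mat N) a \<alpha>"
begin

lemma a_carrier: "a \<in> carrier_vec 2"
  using eigenvector N carrier_GL2Z by (auto simp: eigenvector_def)

lemma N_eq: "real_mat N *\<^sub>v a = \<alpha> \<cdot>\<^sub>v a"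
  using eigenvector by (auto simp: eigenvector_def)

lemma a_nonzero: "a $ 0 \<noteq> 0 \<or> a $ 1 \<noteq> 0"
  using eigenvector N carrier_GL2Z a_carrier
  by (auto simp: eigenvector_def vec_eq_iff less_Suc_eq numeral_2_eq_2)

text \<open>Used both for closure of the stabilizer under products and for multiplicativity of the
  eigenvalue.\<close>

lemma eigen_mult:
  assumes K: "K \<in> carrier_mat 2 2" "real_mat K *\<^sub>v a = c \<cdot>\<^sub>v a"
    and L: "L \<in> carrier_mat 2 2" "real_mat L *\<^sub>v a = d \<cdot>\<^sub>v a"
  shows "real_mat (K * L) *\<^sub>v a = (c * d) \<cdot>\<^sub>v a"
proof -
  have "real_mat (K * L) *\<^sub>v a = (real_mat K * real_mat L) *\<^sub>v a"
    by (simp only: real_mat_mult[OF K(1) L(1)])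
  also have "\<dots> = real_mat K *\<^sub>v (real_mat L *\<^sub>v a)"
    using K(1) L(1) a_carrier by (intro assoc_mult_mat_vec) auto
  also have "\<dots> = d \<cdot>\<^sub>v (real_mat K *\<^sub>v a)"
    unfolding L(2) using K(1) a_carrier by (intro mult_mat_vec) auto
  also have "\<dots> = (c * d) \<cdot>\<^sub>v a"
    by (simp only: K(2) smult_smult_assoc mult.commute)
  finally show ?thesis .
qed

text \<open>Chaining the two coordinate equations gives \<open>(c - ?p) * (c - ?s) = ?q * ?r\<close>
  multiplied by either coordinate of \<open>a\<close>; a nonzero coordinate cancels.\<close>

lemma trace_det:
  assumes K: "K \<in> carrier_mat 2 2" and eq: "real_mat K *\<^sub>v a = c \<cdot>\<^sub>v a"
  shows "c\<^sup>2 - of_int (K $$ (0,0) + K $$ (1,1)) * c + of_int (det K) = 0"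
proof -
  let ?p = "real_of_int (K $$ (0,0))" and ?q = "real_of_int (K $$ (0,1))"
  let ?r = "real_of_int (K $$ (1,0))" and ?s = "real_of_int (K $$ (1,1))"
  have e: "?p * a $ 0 + ?q * a $ 1 = c * a $ 0" "?r * a $ 0 + ?s * a $ 1 = c * a $ 1"
    using eq real_mat_mult_eq_smult_iff[OF K a_carrier] by auto
  then have f: "(c - ?p) * a $ 0 = ?q * a $ 1" "(c - ?s) * a $ 1 = ?r * a $ 0"
    by (simp_all add: left_diff_distrib)
  have "((c - ?p) * (c - ?s)) * a $ 0 = (c - ?s) * ((c - ?p) * a $ 0)"
    by (simp only: mult_ac)
  also have "\<dots> = ?q * ((c - ?s) * a $ 1)"
    unfolding f(1) by (rule mult.left_commute)
  also have "\<dots> = (?q * ?r) * a $ 0"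
    unfolding f(2) by (rule mult.assoc[symmetric])
  finally have 0: "((c - ?p) * (c - ?s)) * a $ 0 = (?q * ?r) * a $ 0" .
  have "((c - ?p) * (c - ?s)) * a $ 1 = (c - ?p) * ((c - ?s) * a $ 1)"
    by (simp only: mult_ac)
  also have "\<dots> = ?r * ((c - ?p) * a $ 0)"
    unfolding f(2) by (rule mult.left_commute)
  also have "\<dots> = (?q * ?r) * a $ 1"
    unfolding f(1) by (simp only: mult_ac)
  finally have "((c - ?p) * (c - ?s)) * a $ 1 = (?q * ?r) * a $ 1" .
  with 0 have "(c - ?p) * (c - ?s) = ?q * ?r"
    using a_nonzero by auto
  then show ?thesis
    by (simp add: det_carrier_mat_2[OF K] power2_eq_square algebra_simps)
qed

lemma irrational: "\<alpha> \<notin> \<rat>"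
  using rational_root_unit[OF trace_det[OF _ N_eq] det_GL2Z[OF N]] N carrier_GL2Z gt_1 by auto

text \<open>A relation with \<open>y\<close> nonzero makes \<open>a $ 1\<close> a rational multiple
  of \<open>a $ 0\<close>, and the first row of \<open>N\<close> then makes \<alpha>
  rational.\<close>

lemma rational_relation_trivial:
  fixes x y :: int
  assumes eq: "of_int x * a $ 0 + of_int y * a $ 1 = 0"
  shows "x = 0" "y = 0"
proof -
  let ?p = "real_of_int (N $$ (0,0))" and ?q = "real_of_int (N $$ (0,1))"
  let ?r = "real_of_int (N $$ (1,0))" and ?s = "real_of_int (N $$ (1,1))"
  have e: "?p * a $ 0 + ?q * a $ 1 = \<alpha> * a $ 0" "?r * a $ 0 + ?s * a $ 1 = \<alpha> * a $ 1"
    using N_eq real_mat_mult_eq_smult_iff[OF _ a_carrier] N carrier_GL2Z by auto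
  \<comment> \<open>If a coordinate vanished, \<alpha> would equal a diagonal entry of
    \<open>N\<close>.\<close>
  have a0: "a $ 0 \<noteq> 0"
    using e(2) irrational a_nonzero by auto
  have a1: "a $ 1 \<noteq> 0"
    using e(1) irrational a_nonzero by auto
  have y: "y = 0"
  proof (rule ccontr)
    assume "y \<noteq> 0"
    \<comment> \<open>The first row is multiplied by \<open>y\<close>, and \<open>y * a $ 1\<close>
      is replaced by \<open>- x * a $ 0\<close>.\<close>
    have "(of_int y * \<alpha>) * a $ 0 = (of_int y * ?p - ?q * of_int x) * a $ 0"
    proof -
      have "of_int y * a $ 1 = - (of_int x * a $ 0)"
        using eq by linarith
      then have "?q * (of_int y * a $ 1) = - (?q * of_int x * a $ 0)"
        by simp
      then show ?thesis
        using arg_cong[OF e(1), of "\<lambda>z. of_int y * z"] by (simp add: algebra_simps)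
    qed
    then have "of_int y * \<alpha> = of_int y * ?p - ?q * of_int x"
      using a0 by simp
    then have "\<alpha> = (of_int y * ?p - ?q * of_int x) / of_int y"
      using \<open>y \<noteq> 0\<close> by (simp add: field_simps)
    also have "\<dots> \<in> \<rat>"
      by (intro Rats_divide Rats_diff Rats_mult Rats_of_int)
    finally show False
      using irrational by contradiction
  qed
  with eq a0 show "x = 0" "y = 0"
    by auto
qed

text \<open>Each row of \<open>K - L\<close> annihilates \<open>a\<close>, which is an integer
  relation between the coordinates of \<open>a\<close>.\<close>

lemma eigenvalue_determines_matrix:
  assumes "K \<in> carrier_mat 2 2" "L \<in> carrier_mat 2 2"
    and "real_mat K *\<^sub>v a = c \<cdot>\<^sub>v a" "real_mat L *\<^sub>v a = c \<cdot>\<^sub>v a"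
  shows "K = L"
proof -
  have "of_int (K $$ (i,0) - L $$ (i,0)) * a $ 0 + of_int (K $$ (i,1) - L $$ (i,1)) * a $ 1 = 0"
    if "i = 0 \<or> i = 1" for i
    using that assms real_mat_mult_eq_smult_iff[OF _ a_carrier] by (auto simp: algebra_simps)
  from rational_relation_trivial[OF this]
  have "K $$ (i,j) = L $$ (i,j)" if "i = 0 \<or> i = 1" "j = 0 \<or> j = 1" for i j
    using that by fastforce
  then show ?thesis
    using assms by (intro eq_matI) (auto simp: numeral_2_eq_2 less_Suc_eq)
qed

text \<open>Provides the discreteness of the image; ranging over all of \<open>GL2Z\<close> lets it
  serve every subgroup.\<close>

lemma finite_eigenvalues:
  "finite {c. 1 < c \<and> c \<le> B \<and> (\<exists>K \<in> carrier GL2Z. real_mat K *\<^sub>v a = c \<cdot>\<^sub>v a)}"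
    (is "finite ?C")
proof -
  let ?P = "\<lambda>t d. [:real_of_int d, - real_of_int t, 1:]"
  let ?U = "\<Union>t\<in>{- \<lceil>B\<rceil> - 1..\<lceil>B\<rceil> + 1}. \<Union>d\<in>{1,-1}. {c. poly (?P t d) c = 0}"
  have "?C \<subseteq> ?U"
  proof
    fix c
    assume "c \<in> ?C"
    then obtain K where c: "1 < c" "c \<le> B" and K: "K \<in> carrier GL2Z"
      and eq: "real_mat K *\<^sub>v a = c \<cdot>\<^sub>v a"
      by blast
    define t where "t = K $$ (0,0) + K $$ (1,1)"
    have root: "c\<^sup>2 - of_int t * c + of_int (det K) = 0"
      unfolding t_def using K carrier_GL2Z by (intro trace_det eq) auto
    have "\<bar>real_of_int (det K) / c\<bar> \<le> 1"
      using det_GL2Z[OF K] c by auto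
    \<comment> \<open>Dividing the characteristic equation by \<open>c\<close> expresses the trace
      as \<open>c\<close> plus an error of absolute value at most 1.\<close>
    moreover have "real_of_int t = c + of_int (det K) / c"
      using root c by (simp add: field_simps power2_eq_square)
    ultimately have "\<bar>real_of_int t\<bar> \<le> B + 1"
      using c by linarith
    then have "t \<in> {- \<lceil>B\<rceil> - 1..\<lceil>B\<rceil> + 1}"
      by (simp add: abs_le_iff) linarith
    moreover have "poly (?P t (det K)) c = 0"
      using root by (simp add: power2_eq_square algebra_simps)
    ultimately show "c \<in> ?U"
      using det_GL2Z[OF K] by blast
  qed
  moreover have "finite ?U"
    by (intro finite_UN_I poly_roots_finite) auto
  ultimately show ?thesis
    by (rule finite_subset)
qed

section \<open>The positive stabilizer and its eigenvalue character\<close>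

lemma subgroup_stabilizer:
  "subgroup {K \<in> carrier GL2Z. K * N = N * K \<and> (\<exists>c>0. real_mat K *\<^sub>v a = c \<cdot>\<^sub>v a)} GL2Z"
    (is "subgroup ?S _")
proof -
  interpret G: group GL2Z by (rule group_GL2Z)
  have carr: "K \<in> carrier_mat 2 2" if "K \<in> carrier GL2Z" for K
    using that carrier_GL2Z by auto
  show ?thesis
  proof (rule G.subgroupI)
    show "?S \<noteq> {}"
      using N gt_1 N_eq by (auto intro!: exI[of _ N] exI[of _ \<alpha>])
  next
    fix K
    assume "K \<in> ?S"
    then obtain c where K: "K \<in> carrier GL2Z" "K * N = N * K" "0 < c"
      and eq: "real_mat K *\<^sub>v a = c \<cdot>\<^sub>v a"
      by blast
    define J where "J = inv\<^bsub>GL2Z\<^esub> K"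
    have J: "J \<in> carrier GL2Z" "J * K = 1\<^sub>m 2"
      using G.inv_closed[OF K(1)] G.l_inv[OF K(1)] by (auto simp: J_def mult_GL2Z one_GL2Z)
    have "J \<otimes>\<^bsub>GL2Z\<^esub> N = N \<otimes>\<^bsub>GL2Z\<^esub> J"
      unfolding J_def using K(2) N K(1)
      by (metis G.inv_closed G.inv_solve_left' G.inv_solve_right G.m_assoc G.m_closed mult_GL2Z)
    \<comment> \<open>Applying the inverse \<open>J\<close> to \<open>K a = c a\<close> gives
      \<open>a = c (J a)\<close>, so \<open>J\<close> has the positive eigenvalue
      \<open>inverse c\<close>.\<close>
    moreover have "c \<cdot>\<^sub>v (real_mat J *\<^sub>v a) = a"
    proof -
      have "c \<cdot>\<^sub>v (real_mat J *\<^sub>v a) = real_mat J *\<^sub>v (c \<cdot>\<^sub>v a)"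
        using carr[OF J(1)] a_carrier by (intro mult_mat_vec[symmetric]) auto
      also have "\<dots> = (real_mat J * real_mat K) *\<^sub>v a"
        unfolding eq[symmetric] using carr[OF J(1)] carr[OF K(1)] a_carrier
        by (intro assoc_mult_mat_vec[symmetric]) auto
      also have "\<dots> = real_mat (J * K) *\<^sub>v a"
        using carr[OF J(1)] carr[OF K(1)] by (simp add: real_mat_mult)
      also have "\<dots> = a"
        using a_carrier by (simp add: J(2) of_int_hom.mat_hom_one)
      finally show ?thesis .
    qed
    then have "real_mat J *\<^sub>v a = inverse c \<cdot>\<^sub>v a"
      using \<open>0 < c\<close> by (metis left_inverse less_irrefl one_smult_vec smult_smult_assoc)
    ultimately show "inv\<^bsub>GL2Z\<^esub> K \<in> ?S"
      using J(1) \<open>0 < c\<close> by (auto simp: J_def[symmetric] mult_GL2Z intro!: exI[of _ "inverse c"])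
  next
    fix K L
    assume "K \<in> ?S" "L \<in> ?S"
    then obtain c d where K: "K \<in> carrier GL2Z" "K * N = N * K" "0 < c"
      and L: "L \<in> carrier GL2Z" "L * N = N * L" "0 < d"
      and eq: "real_mat K *\<^sub>v a = c \<cdot>\<^sub>v a" "real_mat L *\<^sub>v a = d \<cdot>\<^sub>v a"
      by blast
    have "(K * L) * N = N * (K * L)"
      using carr[OF K(1)] carr[OF L(1)] carr[OF N] K(2) L(2)
      by (metis assoc_mult_mat)
    moreover have "real_mat (K * L) *\<^sub>v a = (c * d) \<cdot>\<^sub>v a"
      using carr K L eq by (intro eigen_mult)
    ultimately show "K \<otimes>\<^bsub>GL2Z\<^esub> L \<in> ?S"
      using G.m_closed[OF K(1) L(1)] K(3) L(3)
      by (auto simp: mult_GL2Z intro!: exI[of _ "c * d"])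
  qed auto
qed

text \<open>\<open>H\<close> stands for \<open>SL2Z\<close> or the whole of \<open>GL2Z\<close>.
  Membership is asked of \<open>N * N\<close> rather than \<open>N\<close>, since \<open>N\<close>
  may have determinant -1 while its square has determinant 1.\<close>

lemma infinite_cyclic_Zplus:
  assumes H: "subgroup H GL2Z" and sq: "N * N \<in> H"
  shows "infinite_cyclic_group (Zplus (GL2Z\<lparr>carrier := H\<rparr>) N a)"
proof -
  interpret G: group GL2Z by (rule group_GL2Z)
  define S where "S = {K \<in> H. K * N = N * K \<and> (\<exists>c>0. real_mat K *\<^sub>v a = c \<cdot>\<^sub>v a)}"
  have Z: "Zplus (GL2Z\<lparr>carrier := H\<rparr>) N a = GL2Z\<lparr>carrier := S\<rparr>"
    by (simp add: Zplus_def S_def)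
  have "S = H \<inter> {K \<in> carrier GL2Z. K * N = N * K \<and> (\<exists>c>0. real_mat K *\<^sub>v a = c \<cdot>\<^sub>v a)}"
    using subgroup.subset[OF H] by (auto simp: S_def)
  then have "subgroup S GL2Z"
    using G.subgroups_Inter_pair[OF H subgroup_stabilizer] by simp
  then interpret Z: group "GL2Z\<lparr>carrier := S\<rparr>"
    by (rule G.subgroup_imp_group)
  have carr: "K \<in> carrier_mat 2 2" if "K \<in> carrier GL2Z" for K
    using that carrier_GL2Z by auto
  have S_GL: "S \<subseteq> carrier GL2Z"
    using subgroup.subset[OF H] by (auto simp: S_def)
  \<comment> \<open>The eigenvalue of \<open>K\<close> at \<open>a\<close>. It is unique because
    \<open>a\<close> is nonzero, and it exists for every \<open>K\<close> in
    \<open>S\<close>.\<close>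
  define h where "h K = (THE c. real_mat K *\<^sub>v a = c \<cdot>\<^sub>v a)" for K
  have h: "h K = c" if "real_mat K *\<^sub>v a = c \<cdot>\<^sub>v a" for K c
    unfolding h_def using that
  proof (rule the_equality)
    fix d assume "real_mat K *\<^sub>v a = d \<cdot>\<^sub>v a"
    with that have "c \<cdot>\<^sub>v a = d \<cdot>\<^sub>v a" by simp
    then show "d = c"
      using a_nonzero a_carrier by (auto simp: vec_eq_iff dest: spec[of _ 0] spec[of _ 1])
  qed
  have hS: "real_mat K *\<^sub>v a = h K \<cdot>\<^sub>v a" "0 < h K" if "K \<in> S" for K
    using that h by (auto simp: S_def)
  have NN: "real_mat (N * N) *\<^sub>v a = (\<alpha> * \<alpha>) \<cdot>\<^sub>v a"
    using carr[OF N] N_eq by (intro eigen_mult)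
  show ?thesis
    unfolding Z
  proof (rule Z.infinite_cyclic_group_if_discrete_character[where h = h])
    show "0 < h K" if "K \<in> carrier (GL2Z\<lparr>carrier := S\<rparr>)" for K
      using that hS by simp
    show "h (K \<otimes>\<^bsub>GL2Z\<lparr>carrier := S\<rparr>\<^esub> L) = h K * h L"
      if "K \<in> carrier (GL2Z\<lparr>carrier := S\<rparr>)" "L \<in> carrier (GL2Z\<lparr>carrier := S\<rparr>)" for K L
    proof -
      have KL: "K \<in> S" "L \<in> S" "K \<in> carrier_mat 2 2" "L \<in> carrier_mat 2 2"
        using that S_GL carr by auto
      have "real_mat (K * L) *\<^sub>v a = (h K * h L) \<cdot>\<^sub>v a"
        using KL hS by (intro eigen_mult)
      then show ?thesis
        by (simp add: mult_GL2Z h)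
    qed
    show "inj_on h (carrier (GL2Z\<lparr>carrier := S\<rparr>))"
    proof (rule inj_onI)
      fix K L
      assume "K \<in> carrier (GL2Z\<lparr>carrier := S\<rparr>)" "L \<in> carrier (GL2Z\<lparr>carrier := S\<rparr>)" "h K = h L"
      then show "K = L"
        using eigenvalue_determines_matrix[of K L "h K"] hS S_GL carr by auto
    qed
    then have inj: "inj_on h S" by simp
    \<comment> \<open>By injectivity, matrices are counted by their eigenvalues.\<close>
    show "finite {K \<in> carrier (GL2Z\<lparr>carrier := S\<rparr>). 1 < h K \<and> h K \<le> B}" for B
    proof (rule inj_on_finite)
      show "inj_on h {K \<in> carrier (GL2Z\<lparr>carrier := S\<rparr>). 1 < h K \<and> h K \<le> B}"
        using inj by (rule inj_on_subset) auto
      show "finite {c. 1 < c \<and> c \<le> B \<and> (\<exists>K \<in> carrier GL2Z. real_mat K *\<^sub>v a = c \<cdot>\<^sub>v a)}"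
        by (rule finite_eigenvalues)
    qed (use hS S_GL in auto)
    \<comment> \<open>The required element of value above 1: its eigenvalue is the square of
      \<alpha>.\<close>
    show "N * N \<in> carrier (GL2Z\<lparr>carrier := S\<rparr>)"
      using sq NN gt_1 carr[OF N] by (auto simp: S_def intro!: exI[of _ "\<alpha> * \<alpha>"])
    show "1 < h (N * N)"
      using h[OF NN] gt_1 by (simp add: less_1_mult)
  qed
qed

end

section \<open>The special linear subgroup and both cases of the theorem\<close>

text \<open>This is the kernel of the determinant, which is multiplicative on
  \<open>GL2Z\<close>.\<close>

lemma subgroup_det_1: "subgroup {K \<in> carrier GL2Z. det K = 1} GL2Z"
proof -
  interpret group GL2Z by (rule group_GL2Z)
  have det: "det (K \<otimes>\<^bsub>GL2Z\<^esub> L) = det K * det L"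
    if "K \<in> carrier GL2Z" "L \<in> carrier GL2Z" for K L
    using that carrier_GL2Z by (auto simp: mult_GL2Z intro: det_mult)
  show ?thesis
  proof (rule subgroupI)
    show "{K \<in> carrier GL2Z. det K = 1} \<noteq> {}"
      using one_closed by (auto simp: one_GL2Z intro!: exI[of _ "1\<^sub>m 2"])
    show "inv\<^bsub>GL2Z\<^esub> K \<in> {K \<in> carrier GL2Z. det K = 1}"
      if "K \<in> {K \<in> carrier GL2Z. det K = 1}" for K
      using that det[of "inv\<^bsub>GL2Z\<^esub> K" K] by (auto simp: one_GL2Z)
  qed (auto simp: det)
qed

theorem proposition5p1:
  fixes N :: "int mat" and \<alpha> :: real and a :: "real vec"
  assumes "N \<in> carrier GL2Z"
    and "spectrum (real_mat N) \<inter> {1<..} \<noteq> {}"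
    and "\<alpha> \<in> spectrum (real_mat N) \<inter> {1<..}"
    and "eigenvector (real_mat N) a \<alpha>"
  shows "infinite_cyclic_group (Zplus SL2Z N a) \<and>
    (\<alpha> \<notin> \<rat> \<longrightarrow> infinite_cyclic_group (Zplus GL2Z N a))"
proof -
  interpret unimodular_eigenvector N \<alpha> a
    using assms by unfold_locales auto
  interpret G: group GL2Z by (rule group_GL2Z)
  have sq: "N * N \<in> carrier GL2Z"
    using G.m_closed[OF N N] by (simp add: mult_GL2Z)
  have "det (N * N) = 1"
    using det_mult[of N 2 N] det_GL2Z[OF N] N carrier_GL2Z by auto
  then have "infinite_cyclic_group (Zplus SL2Z N a)"
    unfolding SL2Z_def using sq by (intro infinite_cyclic_Zplus subgroup_det_1) simp
  \<comment> \<open>Here \<open>H\<close> is the full carrier, so restricting to it gives back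
    \<open>GL2Z\<close> itself.\<close>
  moreover have "infinite_cyclic_group (Zplus GL2Z N a)"
    using infinite_cyclic_Zplus[OF G.subgroup_self sq] by simp
  ultimately show ?thesis
    by blast
qed

end
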